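(* Let $\beta:\mathbb R\to(0,+\infty)$ be a smooth function with $\beta(r)>\beta(0)$ for all $r>0$ and $\beta'(0)>0$, let $\mathbf B(q)=\beta\left(\frac{q_1^2+q_2^2}{2}\right)$ on $\mathbb R^2$, and let $\mathscr L_{h,\mathbf A}=(-ih\nabla-\mathbf A)^2$ be the magnetic Laplacian with the radial-gauge potential $\mathbf A$ defined in the context. For all $m\in\mathbb N$, there exist (i) a smooth non-negative function $\varphi$ defined on $[0,+\infty)$, namely $$\varphi(\rho):=\frac12\int_0^\rho\int_0^1\beta(\xi\tau)\,d\xi\,d\tau;$$ (ii) a sequence of smooth real-valued functions $(a_{m,j})_{j\in\mathbb N}$ defined on $[0,\infty)$, with $a_{m,0}>0$; (iii) a sequence of real numbers $(\mu_{m,j})_{j\in\mathbb N}$ with $$\mu_{m,0}=\beta(0),\qquad \mu_{m,1}=2m\frac{\sqrt{\det H}}{\beta(0)}+\frac{(\mathrm{Tr}\,H^{1/2})^2}{2\beta(0)},\qquad H=\tfrac12\mathrm{Hess}\,\mathbf B(0);$$ such that, setting $$P(q)=\varphi\left(\frac{\|q\|^2}{2}\right),\qquad U_{m,j}(q)=a_{m,j}\left(\frac{\|q\|^2}{2}\right),\qquad \theta(q)=\arg(q_1+iq_2),$$ for all $J\in\mathbb N$, $$e^{P/h}\left(\frac{\|q\|^2}{2}\right)^{-\frac m2}\left(\mathscr L_{h,\mathbf A}-h\sum_{j=0}^J\mu_{m,j}h^j\right)\left(e^{im\theta(q)}\left(\frac{\|q\|^2}{2}\right)^{\frac m2}e^{-P/h}\sum_{j=0}^JU_{m,j}h^j\right)=\mathcal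 O(h^{J+2})$$ as $h\to0^+$, locally uniformly in $\mathbb R^2$.
   Context: $\mathbb N=\{0,1,2,\dots\}$. The potential is $\mathbf A=(A_1,A_2)$ with $A_1(q)=-q_2\,\alpha(q)$, $A_2(q)=q_1\,\alpha(q)$, $\alpha(q)=\int_0^1t\,\mathbf B(tq)\,dt$, so that $\partial_{q_1}A_2-\partial_{q_2}A_1=\mathbf B$. In the displayed estimate the left-hand side is considered for $q\neq0$ (because of $\theta$ and the negative power of $\|q\|$); the estimate is uniform on bounded sets of such $q$. *)

theory Defs
  imports "HOL-Analysis.Analysis"
begin

(* On {0..} the derivatives at 0 are one-sided, so smooth_on {0..} is smoothness up to the
   boundary point. *)
definition smooth_on :: "real set \<Rightarrow> (real \<Rightarrow> real) \<Rightarrow> bool" where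
  "smooth_on S f \<longleftrightarrow>
     (\<exists>D :: nat \<Rightarrow> real \<Rightarrow> real. (\<forall>x\<in>S. D 0 x = f x) \<and>
        (\<forall>n. \<forall>x\<in>S. (D n has_real_derivative D (Suc n) x) (at x within S)))"

definition partial_deriv :: "'n::finite \<Rightarrow> (real^'n \<Rightarrow> 'a::real_normed_vector) \<Rightarrow> real^'n \<Rightarrow> 'a" where
  "partial_deriv k u q = vector_derivative (\<lambda>t. u (q + t *\<^sub>R axis k 1)) (at 0)"

definition Hess :: "(real^'n::finite \<Rightarrow> real) \<Rightarrow> real^'n \<Rightarrow> real^'n^'n" where
  "Hess f q = (\<chi> i j. partial_deriv i (partial_deriv j f) q)"

definition pos_semidef :: "real^'n::finite^'n \<Rightarrow> bool" where
  "pos_semidef S \<longleftrightarrow> transpose S = S \<and> (\<forall>x. 0 \<le> x \<bullet> (S *v x))"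

(* The positive semidefinite square root; a meaningful value only if the matrix is itself
   symmetric positive semidefinite. *)
definition matrix_sqrt :: "real^'n::finite^'n \<Rightarrow> real^'n^'n" where
  "matrix_sqrt M = (THE S. pos_semidef S \<and> S ** S = M)"

definition radial_gauge :: "(real^2 \<Rightarrow> real) \<Rightarrow> real^2 \<Rightarrow> real^2" where
  "radial_gauge B q =
     (let \<alpha> = integral {0..1} (\<lambda>t. t * B (t *\<^sub>R q)) in vector [- (q $ 2) * \<alpha>, q $ 1 * \<alpha>])"

definition magnetic_momentum ::
    "real \<Rightarrow> (real^2 \<Rightarrow> real^2) \<Rightarrow> 2 \<Rightarrow> (real^2 \<Rightarrow> complex) \<Rightarrow> real^2 \<Rightarrow> complex" where
  "magnetic_momentum h A k u q =
     - \<i> * of_real h * partial_deriv k u q - of_real (A q $ k) * u q"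

definition magnetic_laplacian ::
    "real \<Rightarrow> (real^2 \<Rightarrow> real^2) \<Rightarrow> (real^2 \<Rightarrow> complex) \<Rightarrow> real^2 \<Rightarrow> complex" where
  "magnetic_laplacian h A u q =
     (\<Sum>k\<in>UNIV. magnetic_momentum h A k (magnetic_momentum h A k u) q)"

(* F h = O(h^N) as h tends to 0 from the right, locally uniformly in the plane, for functions
   F h that are only considered away from the origin: the bounded set K may accumulate at 0,
   so the constant is uniform up to the origin. *)
definition bigo_loc_unif_punctured :: "(real \<Rightarrow> real^2 \<Rightarrow> complex) \<Rightarrow> nat \<Rightarrow> bool" where
  "bigo_loc_unif_punctured F N \<longleftrightarrow>
     (\<forall>K. bounded K \<longrightarrow>
        (\<exists>C. \<forall>\<^sub>F h in at_right 0. \<forall>q\<in>K - {0}. cmod (F h q) \<le> C * h ^ N))"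

end

theory Submission
  imports Defs
begin

text \<open>With \<open>\<rho> = \<parallel>q\<parallel>\<^sup>2/2\<close> and \<open>z = q\<^sub>1 + i q\<^sub>2\<close>, the radial gauge reads
  \<open>A = \<phi>'(\<rho>) (-q\<^sub>2, q\<^sub>1)\<close> with \<open>2 (\<rho> \<phi>')' = \<beta>\<close>, and conjugating the magnetic Laplacian by
  \<open>z\<^sup>m e\<^bsup>-\<phi>(\<rho>)/h\<^esup>\<close> gives, on radial functions \<open>f(\<rho>)\<close>, the operator
  \<open>h (\<beta> f + 4 \<rho> \<phi>' f' - 2 h ((m + 1) f' + \<rho> f''))\<close>. Expanding \<open>f\<close> in powers of \<open>h\<close> leads to a
  hierarchy of transport equations that degenerate at \<open>\<rho> = 0\<close>. Each is solved smoothly by Hadamard's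
  lemma as soon as its right-hand side vanishes at \<open>0\<close>, and this solvability condition determines
  \<open>\<mu>\<^sub>j\<close>. As \<open>\<beta>\<close> is smooth and positive on the whole line, all of this takes place on the line
  rather than on the half-line.\<close>

subsection \<open>Smooth functions and degenerate transport equations\<close>

text \<open>Finite orders of differentiability, with the derivative pinned to \<open>deriv\<close>,
  allow closure properties to be proved by induction on the order, without building a family
  \<open>D\<close> for each product or quotient.\<close>

primrec n_times_differentiable :: "nat \<Rightarrow> (real \<Rightarrow> real) \<Rightarrow> bool" where
  "n_times_differentiable 0 f \<longleftrightarrow> True"
| "n_times_differentiable (Suc n) f \<longleftrightarrow>
     (\<forall>x. (f has_real_derivative deriv f x) (at x)) \<and> n_times_differentiable n (deriv f)"

lemma n_times_differentiable_SucI: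
  assumes "\<And>x. (f has_real_derivative f' x) (at x)" "n_times_differentiable n f'"
  shows "n_times_differentiable (Suc n) f"
proof -
  have "deriv f = f'" using assms(1) by (intro ext DERIV_imp_deriv)
  with assms show ?thesis by simp
qed

lemma n_times_differentiable_Suc_imp:
  "n_times_differentiable (Suc n) f \<Longrightarrow> n_times_differentiable n f"
  by (induction n arbitrary: f) auto

text \<open>Two-sided derivatives are unique, so on the whole line the family \<open>D\<close> can
  only consist of the iterates of \<open>deriv\<close>.\<close>

lemma smooth_on_UNIV_iff: "smooth_on UNIV f \<longleftrightarrow> (\<forall>n. n_times_differentiable n f)"
proof
  assume "smooth_on UNIV f"
  then obtain D where D: "\<And>x. D 0 x = f x"
      "\<And>n x. (D n has_real_derivative D (Suc n) x) (at x)"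
    by (auto simp: smooth_on_def)
  have "n_times_differentiable n (D k)" for n k
  proof (induction n arbitrary: k)
    case (Suc n)
    then show ?case by (rule n_times_differentiable_SucI[OF D(2)])
  qed simp
  moreover have "D 0 = f" using D(1) by auto
  ultimately show "\<forall>n. n_times_differentiable n f" by metis
next
  assume f: "\<forall>n. n_times_differentiable n f"
  have "n_times_differentiable n ((deriv ^^ k) f)" for n k
  proof (induction k arbitrary: n)
    case (Suc k)
    from Suc[of "Suc n"] show ?case by simp
  qed (use f in simp)
  from this[of 1] have "((deriv ^^ k) f has_real_derivative (deriv ^^ Suc k) f x) (at x)" for k x
    by simp
  then show "smooth_on UNIV f"
    unfolding smooth_on_def by (intro exI[of _ "\<lambda>n. (deriv ^^ n) f"]) auto
qed

lemma smooth_on_subset: "smooth_on T f \<Longrightarrow> S \<subseteq> T \<Longrightarrow> smooth_on S f"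
  unfolding smooth_on_def by (meson DERIV_subset subsetD)

lemma smooth_imp_DERIV: "smooth_on UNIV f \<Longrightarrow> (f has_real_derivative deriv f x) (at x)"
  unfolding smooth_on_UNIV_iff by (drule spec[of _ 1]) simp

lemma smooth_deriv: "smooth_on UNIV f \<Longrightarrow> smooth_on UNIV (deriv f)"
  unfolding smooth_on_UNIV_iff by (meson n_times_differentiable.simps(2))

lemma smooth_imp_continuous_on: "smooth_on UNIV f \<Longrightarrow> continuous_on S f"
  by (meson DERIV_isCont continuous_at_imp_continuous_on smooth_imp_DERIV)

lemma smooth_if_DERIV_smooth:
  assumes "\<And>x. (f has_real_derivative f' x) (at x)" "smooth_on UNIV f'"
  shows "smooth_on UNIV f"
  unfolding smooth_on_UNIV_iff
  using assms n_times_differentiable_SucI n_times_differentiable_Suc_imp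
  by (meson smooth_on_UNIV_iff)

section \<open>Closure properties of smooth functions on the line\<close>

lemma smooth_const: "smooth_on UNIV (\<lambda>x. c)"
  unfolding smooth_on_def
  by (intro exI[of _ "\<lambda>n x. if n = 0 then c else 0"]) (auto intro!: derivative_eq_intros)

lemma smooth_ident: "smooth_on UNIV (\<lambda>x. x)"
  by (rule smooth_if_DERIV_smooth[OF _ smooth_const[of 1]]) (auto intro!: derivative_eq_intros)

lemma n_times_differentiable_add:
  "n_times_differentiable n f \<Longrightarrow> n_times_differentiable n g \<Longrightarrow> n_times_differentiable n (\<lambda>x. f x + g x)"
proof (induction n arbitrary: f g)
  case (Suc n)
  show ?case
  proof (rule n_times_differentiable_SucI)
    show "((\<lambda>x. f x + g x) has_real_derivative deriv f x + deriv g x) (at x)" for x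
      using Suc.prems by (auto intro!: derivative_eq_intros)
    show "n_times_differentiable n (\<lambda>x. deriv f x + deriv g x)"
      using Suc by simp
  qed
qed simp

lemma n_times_differentiable_mult:
  "n_times_differentiable n f \<Longrightarrow> n_times_differentiable n g \<Longrightarrow> n_times_differentiable n (\<lambda>x. f x * g x)"
proof (induction n arbitrary: f g)
  case (Suc n)
  show ?case
  proof (rule n_times_differentiable_SucI)
    show "((\<lambda>x. f x * g x) has_real_derivative deriv f x * g x + deriv g x * f x) (at x)" for x
      using Suc.prems by (auto intro!: DERIV_mult)
    show "n_times_differentiable n (\<lambda>x. deriv f x * g x + deriv g x * f x)"
      using Suc n_times_differentiable_Suc_imp by (intro n_times_differentiable_add) auto
  qed
qed simp

lemma smooth_add: "smooth_on UNIV f \<Longrightarrow> smooth_on UNIV g \<Longrightarrow> smooth_on UNIV (\<lambda>x. f x + g x)"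
  by (simp add: smooth_on_UNIV_iff n_times_differentiable_add)

lemma smooth_mult: "smooth_on UNIV f \<Longrightarrow> smooth_on UNIV g \<Longrightarrow> smooth_on UNIV (\<lambda>x. f x * g x)"
  by (simp add: smooth_on_UNIV_iff n_times_differentiable_mult)

lemma smooth_minus: "smooth_on UNIV f \<Longrightarrow> smooth_on UNIV (\<lambda>x. - f x)"
  using smooth_mult[OF smooth_const[of "-1"]] by simp

lemma smooth_diff: "smooth_on UNIV f \<Longrightarrow> smooth_on UNIV g \<Longrightarrow> smooth_on UNIV (\<lambda>x. f x - g x)"
  using smooth_add[OF _ smooth_minus] by simp

lemma smooth_sum:
  "(\<And>i. i \<in> I \<Longrightarrow> smooth_on UNIV (f i)) \<Longrightarrow> smooth_on UNIV (\<lambda>x. \<Sum>i\<in>I. f i x)"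
  by (induction I rule: infinite_finite_induct) (auto intro: smooth_const smooth_add)

text \<open>The derivative of 1/f is a product of f' and two copies of 1/f, so order n for 1/f
  itself yields order n + 1. The same bootstrapping handles \<open>exp\<close> below.\<close>

lemma smooth_inverse:
  assumes f: "smooth_on UNIV f" and nz: "\<And>x. f x \<noteq> 0"
  shows "smooth_on UNIV (\<lambda>x. inverse (f x))"
proof -
  have "n_times_differentiable n (\<lambda>x. inverse (f x))" for n
  proof (induction n)
    case (Suc n)
    have "n_times_differentiable n (\<lambda>x. - deriv f x)"
      using f smooth_minus[OF smooth_deriv] by (simp add: smooth_on_UNIV_iff)
    with Suc have "n_times_differentiable n (\<lambda>x. - deriv f x * (inverse (f x) * inverse (f x)))"
      by (intro n_times_differentiable_mult)
    moreover have "((\<lambda>x. inverse (f x)) has_real_derivative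
        - deriv f x * (inverse (f x) * inverse (f x))) (at x)" for x
      using nz by (auto intro!: derivative_eq_intros smooth_imp_DERIV[OF f])
    ultimately show ?case by (rule n_times_differentiable_SucI[rotated])
  qed simp
  then show ?thesis by (simp add: smooth_on_UNIV_iff)
qed

lemma smooth_divide:
  assumes "smooth_on UNIV f" "smooth_on UNIV g" "\<And>x. g x \<noteq> 0"
  shows "smooth_on UNIV (\<lambda>x. f x / g x)"
  unfolding divide_inverse by (intro smooth_mult smooth_inverse assms)

lemma smooth_exp:
  assumes f: "smooth_on UNIV f"
  shows "smooth_on UNIV (\<lambda>x. exp (f x))"
proof -
  have "n_times_differentiable n (\<lambda>x. exp (f x))" for n
  proof (induction n)
    case (Suc n)
    then have "n_times_differentiable n (\<lambda>x. exp (f x) * deriv f x)"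
      using smooth_deriv[OF f] by (intro n_times_differentiable_mult) (auto simp: smooth_on_UNIV_iff)
    moreover have "((\<lambda>x. exp (f x)) has_real_derivative exp (f x) * deriv f x) (at x)" for x
      by (auto intro!: derivative_eq_intros smooth_imp_DERIV[OF f])
    ultimately show ?case by (rule n_times_differentiable_SucI[rotated])
  qed simp
  then show ?thesis by (simp add: smooth_on_UNIV_iff)
qed

section \<open>Averages and Hadamard's lemma\<close>

text \<open>For nonzero x and continuous \<open>g\<close> this is 1/x times the integral of
  \<open>g\<close> from 0 to x, in a form that stays meaningful at x = 0. It provides the quotient
  in Hadamard's lemma and, multiplied by x, the primitive vanishing at 0.\<close>

definition average :: "(real \<Rightarrow> real) \<Rightarrow> real \<Rightarrow> real" where
  "average g x = integral {0..1} (\<lambda>\<xi>. g (\<xi> * x))"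

text \<open>Each differentiation in x under the integral brings down one factor \<xi>. Keeping the
  power of \<xi> makes the family closed under differentiation, so it supplies all derivatives of
  \<open>average g\<close>.\<close>

lemma integral_scaled_has_derivative:
  assumes g: "smooth_on UNIV g"
  shows "((\<lambda>x. integral {0..1} (\<lambda>\<xi>. \<xi> ^ n * g (\<xi> * x))) has_real_derivative
          integral {0..1} (\<lambda>\<xi>. \<xi> ^ Suc n * deriv g (\<xi> * x))) (at x)"
proof -
  have cg: "continuous_on S g" and cdg: "continuous_on S (deriv g)" for S
    using g smooth_deriv smooth_imp_continuous_on by blast+
  have "((\<lambda>x. integral (cbox 0 1) (\<lambda>\<xi>. \<xi> ^ n * g (\<xi> * x))) has_real_derivative
          integral (cbox 0 1) (\<lambda>\<xi>. \<xi> ^ Suc n * deriv g (\<xi> * x))) (at x within UNIV)"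
  proof (rule leibniz_rule_field_derivative)
    show "((\<lambda>x. t ^ n * g (t * x)) has_real_derivative t ^ Suc n * deriv g (t * x)) (at x)" for x t
    proof -
      have "((\<lambda>x. g (t * x)) has_real_derivative deriv g (t * x) * t) (at x)"
        by (rule DERIV_chain2[OF smooth_imp_DERIV[OF g]]) (auto intro!: derivative_eq_intros)
      then show ?thesis by (auto intro!: derivative_eq_intros)
    qed
    show "(\<lambda>\<xi>. \<xi> ^ n * g (\<xi> * x)) integrable_on cbox 0 1" for x
      by (intro integrable_continuous continuous_intros continuous_on_compose2[OF cg[of UNIV]]) auto
    show "continuous_on (UNIV \<times> cbox 0 1) (\<lambda>(x, t). t ^ Suc n * deriv g (t * x))"
      unfolding split_beta
      by (intro continuous_intros continuous_on_compose2[OF cdg[of UNIV]]) auto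
  qed auto
  then show ?thesis by simp
qed

lemma smooth_average:
  assumes g: "smooth_on UNIV g"
  shows "smooth_on UNIV (average g)"
proof -
  have s: "smooth_on UNIV ((deriv ^^ n) g)" for n
    by (induction n) (auto intro: g smooth_deriv)
  show ?thesis
    unfolding smooth_on_def average_def
    by (intro exI[of _ "\<lambda>n x. integral {0..1} (\<lambda>\<xi>. \<xi> ^ n * (deriv ^^ n) g (\<xi> * x))"])
      (use integral_scaled_has_derivative[OF s] in auto)
qed

lemma average_0 [simp]: "average g 0 = g 0"
  by (simp add: average_def)

lemma average_pos:
  assumes "continuous_on UNIV g" "\<And>x. g x > 0"
  shows "average g x > 0"
  unfolding average_def
proof -
  have "integral {0..1} (\<lambda>\<xi>::real. 0::real) < integral {0..1} (\<lambda>\<xi>. g (\<xi> * x))"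
    by (intro integral_less_real continuous_intros continuous_on_compose2[OF assms(1)])
      (use assms(2) in auto)
  then show "integral {0..1} (\<lambda>\<xi>. g (\<xi> * x)) > 0" by simp
qed

lemma ident_mult_average_has_derivative:
  assumes g: "smooth_on UNIV g"
  shows "((\<lambda>x. x * average g x) has_real_derivative g x) (at x)"
proof -
  have cg: "continuous_on S g" and cdg: "continuous_on S (deriv g)" for S
    using g smooth_deriv smooth_imp_continuous_on by blast+
  have d: "(average g has_real_derivative integral {0..1} (\<lambda>\<xi>. \<xi> * deriv g (\<xi> * x))) (at x)"
    using integral_scaled_has_derivative[OF g, of 0 x] by (simp add: average_def[abs_def])
  \<comment> \<open>The integrand is the \<xi>-derivative of \<open>\<xi> * g (\<xi> * x)\<close>;
    its integral is the product rule for \<open>x * average g x\<close>.\<close>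
  have "((\<lambda>\<xi>. g (\<xi> * x) + x * (\<xi> * deriv g (\<xi> * x))) has_integral 1 * g (1 * x) - 0 * g (0 * x)) {0..1}"
  proof (rule fundamental_theorem_of_calculus)
    fix \<xi> :: real
    have "((\<lambda>\<xi>. g (\<xi> * x)) has_real_derivative deriv g (\<xi> * x) * x) (at \<xi>)"
      by (rule DERIV_chain2[OF smooth_imp_DERIV[OF g]]) (auto intro!: derivative_eq_intros)
    then have "((\<lambda>\<xi>. \<xi> * g (\<xi> * x)) has_real_derivative g (\<xi> * x) + x * (\<xi> * deriv g (\<xi> * x))) (at \<xi>)"
      by (auto intro!: derivative_eq_intros)
    then show "((\<lambda>\<xi>. \<xi> * g (\<xi> * x)) has_vector_derivative g (\<xi> * x) + x * (\<xi> * deriv g (\<xi> * x)))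
        (at \<xi> within {0..1})"
      by (simp add: has_real_derivative_iff_has_vector_derivative has_vector_derivative_at_within)
  qed simp
  then have "g x = integral {0..1} (\<lambda>\<xi>. g (\<xi> * x) + x * (\<xi> * deriv g (\<xi> * x)))"
    by (simp add: integral_unique)
  moreover have "(\<lambda>\<xi>. g (\<xi> * x)) integrable_on {0..1}" "(\<lambda>\<xi>. x * (\<xi> * deriv g (\<xi> * x))) integrable_on {0..1}"
    by (intro integrable_continuous_real continuous_intros continuous_on_compose2[OF cg[of UNIV]]
        continuous_on_compose2[OF cdg[of UNIV]]; auto)+
  ultimately have "average g x + x * integral {0..1} (\<lambda>\<xi>. \<xi> * deriv g (\<xi> * x)) = g x"
    by (simp add: average_def Henstock_Kurzweil_Integration.integral_add)
  then show ?thesis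
    using DERIV_mult[OF DERIV_ident d] by (simp add: mult.commute)
qed

text \<open>Hadamard's lemma: both sides have derivative r' and vanish at 0. The extracted factor x
  will cancel the degenerate factor of the transport equations.\<close>

lemma eq_ident_mult_average_deriv:
  assumes r: "smooth_on UNIV r" and r0: "r 0 = 0"
  shows "r x = x * average (deriv r) x"
proof -
  have "((\<lambda>x. r x - x * average (deriv r) x) has_real_derivative 0) (at x)" for x
    using DERIV_diff[OF smooth_imp_DERIV[OF r] ident_mult_average_has_derivative[OF smooth_deriv[OF r]]]
    by simp
  then have "r x - x * average (deriv r) x = r 0 - 0 * average (deriv r) 0"
    by (rule DERIV_isconst_all[rule_format, rotated])
  with r0 show ?thesis by simp
qed

section \<open>Transport equations degenerate at the origin\<close>

text \<open>As v vanishes at 0, Hadamard's lemma cancels x and leaves the regular equation a' = - k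
  a with \<open>k\<close> smooth. The exponential of a primitive solves it and is positive.\<close>

lemma transport_homogeneous_solution:
  fixes p v :: "real \<Rightarrow> real"
  assumes p: "smooth_on UNIV p" "\<And>x. p x > 0" and v: "smooth_on UNIV v" "v 0 = 0"
  obtains a where "smooth_on UNIV a" "\<And>x. a x > 0" "a 0 = 1"
    "\<And>x. v x * a x + x * p x * deriv a x = 0"
proof
  define k where "k x = average (deriv v) x / p x" for x
  define a where "a x = exp (- (x * average k x))" for x
  have p0: "p x \<noteq> 0" for x using p(2)[of x] by simp
  have k: "smooth_on UNIV k"
    unfolding k_def by (intro smooth_divide smooth_average smooth_deriv p v p0)
  show "smooth_on UNIV a"
    unfolding a_def by (intro smooth_exp smooth_minus smooth_mult smooth_ident smooth_average k)
  show "a x > 0" for x by (simp add: a_def)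
  show "a 0 = 1" by (simp add: a_def)
  have "(a has_real_derivative a x * - k x) (at x)" for x
    unfolding a_def[abs_def]
    by (intro DERIV_fun_exp DERIV_minus ident_mult_average_has_derivative k)
  then have "deriv a x = - (a x * k x)" for x by (simp add: DERIV_imp_deriv)
  then show "v x * a x + x * p x * deriv a x = 0" for x
    using eq_ident_mult_average_deriv[OF v, of x] p0[of x] by (simp add: k_def)
qed

text \<open>Variation of constants: with b = a w the equation becomes x p a w' = r. As r vanishes at
  0, Hadamard's lemma cancels x, and w is the primitive of a smooth \<open>k\<close>.\<close>

lemma transport_solution:
  fixes p v a r :: "real \<Rightarrow> real"
  assumes p: "smooth_on UNIV p" "\<And>x. p x > 0"
    and a: "smooth_on UNIV a" "\<And>x. a x > 0" "\<And>x. v x * a x + x * p x * deriv a x = 0"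
    and r: "smooth_on UNIV r" "r 0 = 0"
  obtains b where "smooth_on UNIV b" "b 0 = 0" "\<And>x. v x * b x + x * p x * deriv b x = r x"
proof
  define k where "k x = average (deriv r) x / (p x * a x)" for x
  define b where "b x = a x * (x * average k x)" for x
  have nz: "p x \<noteq> 0" "a x \<noteq> 0" for x using p(2)[of x] a(2)[of x] by simp_all
  have k: "smooth_on UNIV k"
    unfolding k_def by (intro smooth_divide smooth_average smooth_deriv smooth_mult p a r) (simp add: nz)
  show "smooth_on UNIV b"
    unfolding b_def by (intro smooth_mult smooth_ident smooth_average k a)
  show "b 0 = 0" by (simp add: b_def)
  have "(b has_real_derivative deriv a x * (x * average k x) + k x * a x) (at x)" for x
    unfolding b_def[abs_def]
    by (rule DERIV_mult[OF smooth_imp_DERIV[OF a(1)] ident_mult_average_has_derivative[OF k]])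
  then have d: "deriv b x = deriv a x * (x * average k x) + k x * a x" for x by (simp add: DERIV_imp_deriv)
  show "v x * b x + x * p x * deriv b x = r x" for x
  proof -
    have "v x * b x + x * p x * deriv b x =
        (v x * a x + x * p x * deriv a x) * (x * average k x) + x * (p x * (k x * a x))"
      by (simp add: d b_def algebra_simps)
    also have "\<dots> = r x"
      using eq_ident_mult_average_deriv[OF r, of x] nz[of x] by (simp add: a(3) k_def)
    finally show ?thesis .
  qed
qed

text \<open>At x = 0 the left-hand sides vanish, so the right-hand sides must too. Normalising
  a_0(0) = 1 and a_j(0) = 0 for j > 0 reduces this to \<open>\<mu> (Suc j)\<close> = - 2 c
  a_j'(0).\<close>

lemma transport_hierarchy:
  fixes p v :: "real \<Rightarrow> real"
  assumes p: "smooth_on UNIV p" "\<And>x. p x > 0" and v: "smooth_on UNIV v" "v 0 = 0"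
  obtains a :: "nat \<Rightarrow> real \<Rightarrow> real" and \<mu> :: "nat \<Rightarrow> real"
  where "\<And>j. smooth_on UNIV (a j)" "\<And>x. a 0 x > 0"
    "\<And>x. v x * a 0 x + x * p x * deriv (a 0) x = 0"
    "\<And>j x. v x * a (Suc j) x + x * p x * deriv (a (Suc j)) x =
       (\<Sum>k\<le>j. \<mu> (Suc k) * a (j - k) x) + 2 * (c * deriv (a j) x + x * deriv (deriv (a j)) x)"
    "\<mu> 1 = 2 * c * deriv v 0 / p 0"
proof -
  obtain a0 where a0: "smooth_on UNIV a0" "\<And>x. a0 x > 0" "a0 0 = 1"
    "\<And>x. v x * a0 x + x * p x * deriv a0 x = 0"
    using transport_homogeneous_solution[OF p v] by metis
  \<comment> \<open>The values of \<open>\<mu>\<close> are already substituted, so only the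
    functions remain to be chosen.\<close>
  define R where "R f j x = (\<Sum>k\<le>j. - (2 * c * deriv (f k) 0) * f (j - k) x)
      + 2 * (c * deriv (f j) x + x * deriv (deriv (f j)) x)" for f :: "nat \<Rightarrow> real \<Rightarrow> real" and j x
  define Q where "Q f j b \<longleftrightarrow> smooth_on UNIV b \<and>
     (case j of 0 \<Rightarrow> b = a0
      | Suc i \<Rightarrow> b 0 = 0 \<and> (\<forall>x. v x * b x + x * p x * deriv b x = R f i x))" for f j b
  \<comment> \<open>Each equation involves all earlier functions, hence a choice along
    \<open>less_than\<close>; \<open>Q f j\<close> reads \<open>f\<close> only below j.\<close>
  have "\<exists>f. \<forall>j. Q f j (f j)"
  proof (rule dependent_wf_choice)
    show "wf less_than" by simp
    show "Q f j b = Q g j b" if "\<And>i. (i, j) \<in> less_than \<Longrightarrow> f i = g i" for f g j b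
      using that by (cases j) (simp_all add: Q_def R_def less_Suc_eq_le)
    fix j f assume IH: "\<And>i. (i, j) \<in> less_than \<Longrightarrow> Q f i (f i)"
    show "\<exists>b. Q f j b"
    proof (cases j)
      case 0
      then show ?thesis using a0 by (auto simp: Q_def)
    next
      case (Suc i)
      have f: "smooth_on UNIV (f k)" "f k 0 = (if k = 0 then 1 else 0)" if "k \<le> i" for k
        using IH[of k] that Suc a0(3) by (auto simp: Q_def split: nat.splits)
      have "smooth_on UNIV (R f i)"
        unfolding R_def
        by (intro smooth_add smooth_sum smooth_mult smooth_const smooth_ident smooth_deriv f) auto
      moreover have "R f i 0 = 0"
      proof -
        have "(\<Sum>k\<le>i. - (2 * c * deriv (f k) 0) * f (i - k) 0) =
            (\<Sum>k\<le>i. if k = i then - (2 * c * deriv (f k) 0) else 0)"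
          by (intro sum.cong) (auto simp: f(2))
        then show ?thesis by (simp add: R_def)
      qed
      ultimately obtain b where "smooth_on UNIV b" "b 0 = 0"
          "\<And>x. v x * b x + x * p x * deriv b x = R f i x"
        using transport_solution[where p = p and v = v and a = a0] p a0 by metis
      then show ?thesis using Suc by (auto simp: Q_def)
    qed
  qed
  then obtain a where a: "\<And>j. Q a j (a j)" by blast
  have a00: "a 0 = a0" using a[of 0] by (simp add: Q_def)
  show ?thesis
  proof
    show "smooth_on UNIV (a j)" for j using a[of j] by (simp add: Q_def)
    show "a 0 x > 0" "v x * a 0 x + x * p x * deriv (a 0) x = 0" for x
      using a0 by (simp_all add: a00)
    \<comment> \<open>The witness for \<open>\<mu> i\<close> is the term in \<open>i - 1\<close>,
      which is why \<open>Suc k - 1\<close> is left unsimplified.\<close>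
    show "v x * a (Suc j) x + x * p x * deriv (a (Suc j)) x =
       (\<Sum>k\<le>j. (- (2 * c * deriv (a (Suc k - 1)) 0)) * a (j - k) x)
         + 2 * (c * deriv (a j) x + x * deriv (deriv (a j)) x)" for j x
      using a[of "Suc j"] by (simp add: Q_def R_def)
    show "- (2 * c * deriv (a (1 - 1)) 0) = 2 * c * deriv v 0 / p 0"
    proof -
      \<comment> \<open>Differentiating the homogeneous equation at 0, where \<open>a0\<close> is 1
        and \<open>v\<close> is 0, gives the slope of \<open>a0\<close> there.\<close>
      have "((\<lambda>x. v x * a0 x + x * p x * deriv a0 x) has_real_derivative
          deriv v 0 + p 0 * deriv a0 0) (at 0)"
        by (auto intro!: derivative_eq_intros smooth_imp_DERIV smooth_deriv p a0 v simp: a0(3) v(2))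
      moreover have "((\<lambda>x. v x * a0 x + x * p x * deriv a0 x) has_real_derivative 0) (at 0)"
        by (simp add: a0)
      ultimately have "deriv v 0 + p 0 * deriv a0 0 = 0" by (rule DERIV_unique)
      then have "deriv v 0 = - (p 0 * deriv a0 0)" by simp
      then show ?thesis using p(2)[of 0] by (simp add: a00)
    qed
  qed
qed

subsection \<open>The magnetic Laplacian in the radial gauge\<close>

text \<open>\<open>partial_deriv\<close> is total and says nothing about existence. The relation
  carries existence along, so its sum and product rules compose without side conditions.\<close>

definition has_partial_deriv ::
    "'n::finite \<Rightarrow> (real^'n \<Rightarrow> 'a::real_normed_vector) \<Rightarrow> 'a \<Rightarrow> real^'n \<Rightarrow> bool" where
  "has_partial_deriv k u d q \<longleftrightarrow> ((\<lambda>t. u (q + t *\<^sub>R axis k 1)) has_vector_derivative d) (at 0)"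

lemma partial_deriv_eqI: "has_partial_deriv k u d q \<Longrightarrow> partial_deriv k u q = d"
  unfolding has_partial_deriv_def partial_deriv_def by (rule vector_derivative_at)

lemma has_partial_deriv_const: "has_partial_deriv k (\<lambda>q. c) 0 q"
  unfolding has_partial_deriv_def by (rule has_vector_derivative_const)

lemma has_partial_deriv_add:
  "has_partial_deriv k u d q \<Longrightarrow> has_partial_deriv k v e q \<Longrightarrow>
     has_partial_deriv k (\<lambda>q. u q + v q) (d + e) q"
  unfolding has_partial_deriv_def by (rule has_vector_derivative_add)

lemma has_partial_deriv_diff:
  "has_partial_deriv k u d q \<Longrightarrow> has_partial_deriv k v e q \<Longrightarrow>
     has_partial_deriv k (\<lambda>q. u q - v q) (d - e) q"
  unfolding has_partial_deriv_def by (rule has_vector_derivative_diff)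

lemma has_partial_deriv_mult:
  fixes u v :: "real^'n::finite \<Rightarrow> 'a::real_normed_algebra"
  shows "has_partial_deriv k u d q \<Longrightarrow> has_partial_deriv k v e q \<Longrightarrow>
     has_partial_deriv k (\<lambda>q. u q * v q) (u q * e + d * v q) q"
  unfolding has_partial_deriv_def by (drule (1) has_vector_derivative_mult) simp

lemma has_partial_deriv_of_real:
  "has_partial_deriv k u d q \<Longrightarrow>
     has_partial_deriv k (\<lambda>q. of_real (u q) :: 'a::real_normed_algebra_1) (of_real d) q"
  unfolding has_partial_deriv_def
  by (rule has_vector_derivative_of_real) (simp add: has_real_derivative_iff_has_vector_derivative)

lemma has_partial_deriv_component:
  "has_partial_deriv k (\<lambda>q. q $ i) (if i = k then 1 else 0) q"
  unfolding has_partial_deriv_def has_real_derivative_iff_has_vector_derivative[symmetric]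
  by (auto simp: axis_def intro!: derivative_eq_intros)

text \<open>A displacement t along axis k changes half the squared norm by t q_k + t^2/2, whose
  derivative at t = 0 is q_k.\<close>

lemma has_partial_deriv_radial:
  fixes q :: "real^'n::finite"
  assumes "(g has_real_derivative d) (at ((norm q)\<^sup>2 / 2))"
  shows "has_partial_deriv k (\<lambda>q. g ((norm q)\<^sup>2 / 2)) (d * (q $ k)) q"
proof -
  have eq: "(norm (q + t *\<^sub>R axis k 1))\<^sup>2 / 2 = (norm q)\<^sup>2 / 2 + t * (q $ k) + t\<^sup>2 / 2" for t
    unfolding power2_norm_eq_inner
    by (simp add: inner_add_left inner_add_right inner_axis inner_axis' field_simps power2_eq_square)
  have "((\<lambda>t. (norm q)\<^sup>2 / 2 + t * (q $ k) + t\<^sup>2 / 2) has_real_derivative q $ k) (at 0)"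
    by (auto intro!: derivative_eq_intros)
  moreover have "(g has_real_derivative d) (at ((norm q)\<^sup>2 / 2 + 0 * (q $ k) + 0\<^sup>2 / 2))"
    using assms by simp
  ultimately have "((\<lambda>t. g ((norm q)\<^sup>2 / 2 + t * (q $ k) + t\<^sup>2 / 2)) has_real_derivative d * q $ k) (at 0)"
    by (rule DERIV_chain2[of g d "\<lambda>t. (norm q)\<^sup>2 / 2 + t * (q $ k) + t\<^sup>2 / 2" 0, rotated])
  then show ?thesis
    unfolding has_partial_deriv_def eq by (simp add: has_real_derivative_iff_has_vector_derivative)
qed

definition complex_coord :: "real^2 \<Rightarrow> complex" where
  "complex_coord q = Complex (q $ 1) (q $ 2)"

lemma has_partial_deriv_complex_coord:
  "has_partial_deriv k complex_coord (if k = 1 then 1 else \<i>) q"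
proof -
  have "complex_coord = (\<lambda>q. of_real (q $ 1) + \<i> * of_real (q $ 2))"
    by (simp add: complex_coord_def[abs_def] complex_eq_iff fun_eq_iff)
  moreover have "has_partial_deriv k (\<lambda>q. of_real (q $ 1) + \<i> * of_real (q $ 2))
     (of_real (if 1 = k then 1 else 0) + (\<i> * of_real (if 2 = k then 1 else 0) + 0 * of_real (q $ 2))) q"
    by (intro has_partial_deriv_add has_partial_deriv_mult has_partial_deriv_const
        has_partial_deriv_of_real has_partial_deriv_component)
  moreover have "k = 1 \<or> k = 2" by (rule exhaust_2)
  ultimately show ?thesis by auto
qed

lemma has_partial_deriv_power:
  fixes u :: "real^'n::finite \<Rightarrow> 'a::real_normed_field"
  assumes "has_partial_deriv k u d q"
  shows "has_partial_deriv k (\<lambda>q. u q ^ m) (of_nat m * u q ^ (m - 1) * d) q"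
proof -
  have "((\<lambda>x. x ^ m) has_field_derivative of_nat m * u q ^ (m - 1))
      (at (u (q + 0 *\<^sub>R axis k 1)))"
    by (auto intro!: derivative_eq_intros)
  from field_vector_diff_chain_at[OF assms[unfolded has_partial_deriv_def] this]
  show ?thesis by (simp add: has_partial_deriv_def o_def mult.commute)
qed

lemma power2_norm_vec_2: "(norm q)\<^sup>2 = (q $ 1)\<^sup>2 + (q $ 2)\<^sup>2" for q :: "real^2"
  unfolding power2_norm_eq_inner by (simp add: inner_vec_def sum_2 power2_eq_square)

section \<open>Action of the magnetic Laplacian on z^m times a radial function\<close>

text \<open>The partial derivatives 1 and i of z have squares summing to 0, which removes the second
  derivatives of z^m. Paired with q they give z, paired with the rotated vector (-q_2, q_1) they
  give i z, so first derivatives reproduce m z^m. Orthogonality of these two vectors removes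
  p'.\<close>

lemma magnetic_laplacian_power_mult_radial:
  fixes p w :: "real \<Rightarrow> real" and A :: "real^2 \<Rightarrow> real^2"
  assumes A: "\<And>q. A q = vector [- (q $ 2) * p ((norm q)\<^sup>2 / 2), q $ 1 * p ((norm q)\<^sup>2 / 2)]"
    and p: "\<And>x. (p has_real_derivative p' x) (at x)"
    and w: "\<And>x. (w has_real_derivative w' x) (at x)"
    and w': "\<And>x. (w' has_real_derivative w'' x) (at x)"
  defines "\<rho> \<equiv> \<lambda>q::real^2. (norm q)\<^sup>2 / 2"
  shows "magnetic_laplacian h A (\<lambda>q. complex_coord q ^ m * of_real (w (\<rho> q))) q =
    complex_coord q ^ m * of_real (- 2 * h\<^sup>2 * (\<rho> q * w'' (\<rho> q) + (real m + 1) * w' (\<rho> q))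
      - 2 * h * real m * p (\<rho> q) * w (\<rho> q) + 2 * \<rho> q * (p (\<rho> q))\<^sup>2 * w (\<rho> q))"
proof -
  define z where "z = complex_coord"
  define e where "e k = (if k = 1 then 1 else \<i>)" for k :: 2
  define s where "s k q = (if k = 1 then - (q $ 2) else q $ 1)" for k :: 2 and q :: "real^2"
  note rules = has_partial_deriv_add has_partial_deriv_mult has_partial_deriv_const has_partial_deriv_diff
        has_partial_deriv_of_real has_partial_deriv_component has_partial_deriv_power
        has_partial_deriv_radial[OF p] has_partial_deriv_radial[OF w] has_partial_deriv_radial[OF w']
        has_partial_deriv_complex_coord
  have Ak: "A q $ k = s k q * p (\<rho> q)" for k q
    using exhaust_2[of k] by (auto simp: A s_def \<rho>_def)
  \<comment> \<open>Component k of the rotated vector does not involve q_k.\<close>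
  have s: "has_partial_deriv k (s k) 0 q" for k q
  proof -
    have "has_partial_deriv k (\<lambda>q. 0 - q $ 2) (0 - (if 2 = k then 1 else 0)) q"
      "has_partial_deriv k (\<lambda>q. q $ 1) (if 1 = k then 1 else 0) q"
      by (intro rules)+
    then show ?thesis using exhaust_2[of k] by (auto simp: s_def[abs_def])
  qed
  define M where "M k q = - \<i> * of_real h * (z q ^ m * of_real (w' (\<rho> q) * q $ k)
      + of_nat m * z q ^ (m - 1) * e k * of_real (w (\<rho> q)))
      - of_real (s k q * p (\<rho> q)) * (z q ^ m * of_real (w (\<rho> q)))" for k q
  have M: "magnetic_momentum h A k (\<lambda>q. z q ^ m * of_real (w (\<rho> q))) = M k" for k
  proof
    fix q
    have "has_partial_deriv k (\<lambda>q. z q ^ m * of_real (w (\<rho> q)))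
       (z q ^ m * of_real (w' (\<rho> q) * q $ k) + of_nat m * z q ^ (m - 1) * e k * of_real (w (\<rho> q))) q"
      unfolding z_def \<rho>_def e_def by (intro rules)
    from partial_deriv_eqI[OF this]
    show "magnetic_momentum h A k (\<lambda>q. z q ^ m * of_real (w (\<rho> q))) q = M k q"
      by (simp add: magnetic_momentum_def M_def Ak)
  qed
  have M': "partial_deriv k (M k) q = - \<i> * of_real h *
     (z q ^ m * of_real (w'' (\<rho> q) * (q $ k)\<^sup>2 + w' (\<rho> q))
      + 2 * of_nat m * z q ^ (m - 1) * e k * of_real (w' (\<rho> q) * q $ k)
      + of_nat m * of_nat (m - 1) * z q ^ (m - 2) * (e k)\<^sup>2 * of_real (w (\<rho> q)))
     - of_real (s k q) * (of_real (p' (\<rho> q) * q $ k) * z q ^ m * of_real (w (\<rho> q))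
         + of_real (p (\<rho> q)) * of_nat m * z q ^ (m - 1) * e k * of_real (w (\<rho> q))
         + of_real (p (\<rho> q)) * z q ^ m * of_real (w' (\<rho> q) * q $ k))" for k
  proof -
    \<comment> \<open>The derivative is displayed exactly as the product rules assemble it, so that
      they apply by unification.\<close>
    have "has_partial_deriv k (M k)
      (- \<i> * of_real h *
        (z q ^ m * of_real (w' (\<rho> q) * (if k = k then 1 else 0) + w'' (\<rho> q) * q $ k * q $ k)
          + of_nat m * z q ^ (m - 1) * e k * of_real (w' (\<rho> q) * q $ k)
         + (of_nat m * z q ^ (m - 1) * e k * of_real (w' (\<rho> q) * q $ k) +
            (of_nat m * z q ^ (m - 1) * 0 +
              (of_nat m * (of_nat (m - 1) * z q ^ (m - 1 - 1) * e k) + 0 * z q ^ (m - 1)) * e k)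
              * of_real (w (\<rho> q))))
       + 0 * (z q ^ m * of_real (w' (\<rho> q) * q $ k) + of_nat m * z q ^ (m - 1) * e k * of_real (w (\<rho> q)))
       - (of_real (s k q * p (\<rho> q)) * (z q ^ m * of_real (w' (\<rho> q) * q $ k)
            + of_nat m * z q ^ (m - 1) * e k * of_real (w (\<rho> q)))
          + of_real (s k q * (p' (\<rho> q) * q $ k) + 0 * p (\<rho> q)) * (z q ^ m * of_real (w (\<rho> q))))) q"
      unfolding M_def[abs_def] z_def \<rho>_def e_def
      by (intro rules s)
    from partial_deriv_eqI[OF this] show ?thesis
      by (simp add: algebra_simps power2_eq_square numeral_2_eq_2)
  qed
  have z: "z q = of_real (q $ 1) + \<i> * of_real (q $ 2)"
    by (simp add: z_def complex_coord_def complex_eq_iff)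
  \<comment> \<open>For m = 0, where \<open>m - 1\<close> is truncated, both sides are 0.\<close>
  have zm: "of_nat m * z q ^ (m - 1) * z q = of_nat m * z q ^ m"
    by (cases m) auto
  have e: "e 1 = 1" "e 2 = \<i>" "s 1 q = - (q $ 2)" "s 2 q = q $ 1" by (simp_all add: e_def s_def)
  define x y where "x = complex_of_real (q $ 1)" and "y = complex_of_real (q $ 2)"
  define Z Y X where "Z = z q ^ m" and "Y = of_nat m * z q ^ (m - 1)"
    and "X = of_nat m * of_nat (m - 1) * z q ^ (m - 2)"
  define R W W1 W2 Q Q1 N H where "R = complex_of_real (\<rho> q)" and "W = complex_of_real (w (\<rho> q))"
    and "W1 = complex_of_real (w' (\<rho> q))" and "W2 = complex_of_real (w'' (\<rho> q))"
    and "Q = complex_of_real (p (\<rho> q))" and "Q1 = complex_of_real (p' (\<rho> q))"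
    and "N = (of_nat m :: complex)" and "H = complex_of_real h"
  have R: "2 * R = x\<^sup>2 + y\<^sup>2"
    by (simp add: R_def \<rho>_def x_def y_def power2_norm_vec_2)
  have YZ: "Y * (x + \<i> * y) = N * Z"
    using zm z by (simp add: Y_def x_def y_def N_def Z_def)
  have "magnetic_laplacian h A (\<lambda>q. z q ^ m * of_real (w (\<rho> q))) q =
     (- \<i> * H * (- \<i> * H * (Z * (W2 * x\<^sup>2 + W1) + 2 * Y * (W1 * x) + X * W)
        + y * (Q1 * x * Z * W + Q * Y * W + Q * Z * (W1 * x)))
      + y * Q * (- \<i> * H * (Z * (W1 * x) + Y * W) + y * Q * (Z * W)))
     + (- \<i> * H * (- \<i> * H * (Z * (W2 * y\<^sup>2 + W1) + 2 * Y * \<i> * (W1 * y) + X * (-1) * W)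
        - x * (Q1 * y * Z * W + Q * Y * \<i> * W + Q * Z * (W1 * y)))
      - x * Q * (- \<i> * H * (Z * (W1 * y) + Y * \<i> * W) - x * Q * (Z * W)))"
    unfolding magnetic_laplacian_def M sum_2 magnetic_momentum_def[of _ _ _ "M _"] M'
    unfolding M_def Ak
    by (simp add: e Z_def Y_def X_def R_def W_def W1_def W2_def Q_def Q1_def H_def x_def y_def algebra_simps)
  \<comment> \<open>\<open>X\<close> occurs with weights 1 and -1 and cancels, as do the
    \<open>Q1\<close> terms; the \<open>Y\<close> terms group into multiples of
    \<open>Y * (x + \<i> * y)\<close>.\<close>
  also have "\<dots> = - H\<^sup>2 * (Z * (W2 * (x\<^sup>2 + y\<^sup>2) + 2 * W1) + 2 * W1 * (Y * (x + \<i> * y)))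
      - 2 * H * Q * W * (Y * (x + \<i> * y)) + Q\<^sup>2 * Z * W * (x\<^sup>2 + y\<^sup>2)"
    by (simp add: algebra_simps power2_eq_square)
  also have "\<dots> = - H\<^sup>2 * (Z * (W2 * (2 * R) + 2 * W1) + 2 * W1 * (N * Z))
      - 2 * H * Q * W * (N * Z) + Q\<^sup>2 * Z * W * (2 * R)"
    unfolding R YZ ..
  also have "\<dots> = Z * (- 2 * H\<^sup>2 * (R * W2 + (N + 1) * W1) - 2 * H * N * Q * W + 2 * R * Q\<^sup>2 * W)"
    by (simp add: algebra_simps)
  finally show ?thesis
    by (simp add: z_def Z_def R_def W_def W1_def W2_def Q_def N_def H_def)
qed

section \<open>Reduction to smooth representatives off the origin\<close>

text \<open>Differentiation is local and the punctured plane is open. Agreement at 0 cannot be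
  expected later: for m = 0 the factor \<open>0 powr 0\<close> is 0, whereas z^0 is 1.\<close>

lemma partial_deriv_cong_punctured:
  fixes u v :: "real^'n::finite \<Rightarrow> 'a::real_normed_vector"
  assumes eq: "\<And>q. q \<noteq> 0 \<Longrightarrow> u q = v q" and q: "q \<noteq> 0"
  shows "partial_deriv k u q = partial_deriv k v q"
proof -
  have "((\<lambda>t. q + t *\<^sub>R axis k 1) \<longlongrightarrow> q + 0 *\<^sub>R axis k 1) (nhds (0::real))"
    by (intro tendsto_intros filterlim_ident)
  then have "\<forall>\<^sub>F t in nhds (0::real). q + t *\<^sub>R axis k 1 \<noteq> 0"
    using q by (intro tendsto_imp_eventually_ne) auto
  then have *: "\<forall>\<^sub>F t in nhds (0::real). u (q + t *\<^sub>R axis k 1) = v (q + t *\<^sub>R axis k 1)"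
    by eventually_elim (rule eq)
  then have "((\<lambda>t. u (q + t *\<^sub>R axis k 1)) has_vector_derivative d) (at 0) \<longleftrightarrow>
      ((\<lambda>t. v (q + t *\<^sub>R axis k 1)) has_vector_derivative d) (at 0)" for d
    using eq[OF q] by (intro has_vector_derivative_cong_ev) auto
  then show ?thesis by (simp add: partial_deriv_def vector_derivative_def)
qed

text \<open>After one momentum the two functions again agree off the origin, which is all that the
  second application of locality needs.\<close>

lemma magnetic_laplacian_cong_punctured:
  assumes "\<And>q. q \<noteq> 0 \<Longrightarrow> u q = v q" "q \<noteq> 0"
  shows "magnetic_laplacian h A u q = magnetic_laplacian h A v q"
proof -
  have "magnetic_momentum h A k u q = magnetic_momentum h A k v q" if "q \<noteq> 0" for k q
    unfolding magnetic_momentum_def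
    using partial_deriv_cong_punctured[of u v q k] assms(1) that by simp
  then have "magnetic_momentum h A k (magnetic_momentum h A k u) q =
      magnetic_momentum h A k (magnetic_momentum h A k v) q" for k
    unfolding magnetic_momentum_def[of h A k "magnetic_momentum h A k _"]
    using assms(2)
      partial_deriv_cong_punctured[of "magnetic_momentum h A k u" "magnetic_momentum h A k v" q k]
    by simp
  then show ?thesis by (simp add: magnetic_laplacian_def)
qed

text \<open>By the polar form of z, the angular and radial factors combine to the polynomial z^m up
  to a constant, so the branch cut of \<open>Arg\<close> disappears.\<close>

lemma exp_Arg_mult_radius_powr:
  assumes "q \<noteq> 0"
  shows "exp (\<i> * of_nat m * of_real (Arg (complex_coord q))) * of_real (((norm q)\<^sup>2 / 2) powr (real m / 2))
    = complex_coord q ^ m * of_real (2 powr (- (real m / 2)))"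
proof -
  have n: "cmod (complex_coord q) = norm q"
    unfolding complex_coord_def cmod_def norm_eq_sqrt_inner
    by (simp add: inner_vec_def sum_2 power2_eq_square)
  have "complex_coord q = of_real (norm q) * exp (\<i> * of_real (Arg (complex_coord q)))"
    using Arg_eq[of "complex_coord q"] assms n by fastforce
  then have "complex_coord q ^ m = (of_real (norm q) * exp (\<i> * of_real (Arg (complex_coord q)))) ^ m"
    by simp
  also have "\<dots> = of_real (norm q ^ m) * exp (\<i> * of_nat m * of_real (Arg (complex_coord q)))"
    by (simp add: power_mult_distrib exp_of_nat_mult[symmetric] mult_ac)
  finally have z: "complex_coord q ^ m = \<dots>" .
  have "((norm q)\<^sup>2 / 2) powr (real m / 2) = ((norm q)\<^sup>2) powr (real m / 2) * 2 powr (- (real m / 2))"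
    by (simp add: powr_divide powr_minus_divide)
  also have "((norm q)\<^sup>2) powr (real m / 2) = norm q ^ m"
  proof -
    have "((norm q)\<^sup>2) powr (real m / 2) = (norm q powr 2) powr (real m / 2)"
      using assms by simp
    also have "\<dots> = norm q ^ m"
      using assms by (simp add: powr_powr powr_realpow del: powr_numeral)
    finally show ?thesis .
  qed
  finally show ?thesis unfolding z by (simp add: mult_ac)
qed

section \<open>The gauge and the Hessian for a radial field\<close>

text \<open>Substitute s = t^2, using that \<open>s * average g (s * x)\<close> has s-derivative
  \<open>g (s * x)\<close>. The case x = 0 is separate because the chain rule yields this only after
  division by x.\<close>

lemma has_integral_scaled_square:
  assumes g: "smooth_on UNIV g"
  shows "((\<lambda>t. t * g (t\<^sup>2 * x)) has_integral average g x / 2) {0..1}"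
proof -
  have "((\<lambda>s. s * average g (s * x)) has_real_derivative g (s * x)) (at s)" for s
  proof (cases "x = 0")
    case True
    then show ?thesis by (auto intro!: derivative_eq_intros)
  next
    case False
    have "((\<lambda>s. (s * x) * average g (s * x)) has_real_derivative g (s * x) * x) (at s)"
      by (rule DERIV_chain2[OF ident_mult_average_has_derivative[OF g]])
        (auto intro!: derivative_eq_intros)
    from DERIV_cdivide[OF this, of x] show ?thesis using False by simp
  qed
  then have "((\<lambda>t. t\<^sup>2 * average g (t\<^sup>2 * x)) has_real_derivative g (t\<^sup>2 * x) * (2 * t)) (at t)" for t
    by (rule DERIV_chain2) (auto intro!: derivative_eq_intros)
  from DERIV_cdivide[OF this, of 2]
  have d: "((\<lambda>t. (t\<^sup>2 * average g (t\<^sup>2 * x)) / 2) has_real_derivative t * g (t\<^sup>2 * x)) (at t)" for t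
    by (simp add: mult.commute)
  have "((\<lambda>t. t * g (t\<^sup>2 * x)) has_integral (1\<^sup>2 * average g (1\<^sup>2 * x)) / 2 - (0\<^sup>2 * average g (0\<^sup>2 * x)) / 2) {0..1}"
    by (rule fundamental_theorem_of_calculus)
      (auto simp flip: has_real_derivative_iff_has_vector_derivative intro: has_field_derivative_at_within d)
  then show ?thesis by simp
qed

lemma radial_gauge_radial:
  assumes g: "smooth_on UNIV g"
  shows "radial_gauge (\<lambda>q. g ((norm q)\<^sup>2 / 2)) q =
    vector [- (q $ 2) * (average g ((norm q)\<^sup>2 / 2) / 2), q $ 1 * (average g ((norm q)\<^sup>2 / 2) / 2)]"
proof -
  have n: "(norm (t *\<^sub>R q))\<^sup>2 / 2 = t\<^sup>2 * ((norm q)\<^sup>2 / 2)" for t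
    by (simp add: power_mult_distrib)
  show ?thesis
    unfolding radial_gauge_def Let_def n integral_unique[OF has_integral_scaled_square[OF g]] ..
qed

text \<open>The gradient is g' times q; in its derivative the term with g'' carries q_i q_j and
  vanishes at the origin.\<close>

lemma Hess_radial_at_0:
  assumes g: "smooth_on UNIV g"
  shows "Hess (\<lambda>q::real^'n::finite. g ((norm q)\<^sup>2 / 2)) 0 = deriv g 0 *\<^sub>R mat 1"
proof -
  have 1: "partial_deriv j (\<lambda>q::real^'n. g ((norm q)\<^sup>2 / 2)) = (\<lambda>q. deriv g ((norm q)\<^sup>2 / 2) * q $ j)" for j
    by (intro ext partial_deriv_eqI has_partial_deriv_radial smooth_imp_DERIV g)
  have "has_partial_deriv i (\<lambda>q::real^'n. deriv g ((norm q)\<^sup>2 / 2) * q $ j)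
      (deriv g ((norm (0::real^'n))\<^sup>2 / 2) * (if j = i then 1 else 0)
        + deriv (deriv g) ((norm (0::real^'n))\<^sup>2 / 2) * (0::real^'n) $ i * (0::real^'n) $ j) 0" for i j
    by (intro has_partial_deriv_mult has_partial_deriv_radial smooth_imp_DERIV smooth_deriv g
        has_partial_deriv_component)
  then have "partial_deriv i (\<lambda>q::real^'n. deriv g ((norm q)\<^sup>2 / 2) * q $ j) 0 =
      deriv g 0 * (if j = i then 1 else 0)" for i j
    by (intro partial_deriv_eqI) simp
  then show ?thesis
    by (simp add: Hess_def 1 vec_eq_iff mat_def)
qed

lemma matrix_vector_mult_scaleR_mat: "(c *\<^sub>R mat 1) *v x = c *\<^sub>R x" for c :: real and x :: "real^'n::finite"
  by (simp add: scaleR_matrix_vector_assoc[symmetric])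

text \<open>\<open>matrix_sqrt\<close> is a definite description, so uniqueness among positive
  semidefinite roots is needed as well. Scalar matrices are enough for the Hessian of a radial field
  at 0.\<close>

lemma matrix_sqrt_scalar:
  assumes c: "c > 0"
  shows "matrix_sqrt (c\<^sup>2 *\<^sub>R mat 1 :: real^'n::finite^'n) = c *\<^sub>R mat 1"
  unfolding matrix_sqrt_def
proof (rule the_equality)
  have "transpose (c *\<^sub>R mat 1 :: real^'n^'n) = c *\<^sub>R mat 1"
    by (simp add: transpose_def mat_def vec_eq_iff)
  moreover have "(c *\<^sub>R mat 1) ** (c *\<^sub>R mat 1) = (c\<^sup>2 *\<^sub>R mat 1 :: real^'n^'n)"
    by (simp add: matrix_eq matrix_vector_mul_assoc[symmetric] matrix_vector_mult_scaleR_mat power2_eq_square)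
  ultimately show "pos_semidef (c *\<^sub>R mat 1 :: real^'n^'n) \<and>
      (c *\<^sub>R mat 1) ** (c *\<^sub>R mat 1) = (c\<^sup>2 *\<^sub>R mat 1 :: real^'n^'n)"
    using c by (simp add: pos_semidef_def matrix_vector_mult_scaleR_mat)
next
  fix S :: "real^'n^'n"
  assume S: "pos_semidef S \<and> S ** S = c\<^sup>2 *\<^sub>R mat 1"
  have "S *v x = c *\<^sub>R x" for x
  proof -
    \<comment> \<open>\<open>(S + c)(S - c) = 0\<close> and \<open>S + c\<close> is positive definite.\<close>
    define y where "y = S *v x - c *\<^sub>R x"
    have "S *v (S *v x) = c\<^sup>2 *\<^sub>R x"
      using S by (simp add: matrix_vector_mul_assoc matrix_vector_mult_scaleR_mat)
    then have "S *v y = - (c *\<^sub>R y)"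
      by (simp add: y_def matrix_vector_mult_diff_distrib matrix_vector_mult_scaleR
          scaleR_diff_right power2_eq_square)
    then have "y \<bullet> (S *v y) = - (c * (y \<bullet> y))" by simp
    moreover have "0 \<le> y \<bullet> (S *v y)" using S by (simp add: pos_semidef_def)
    ultimately have "y \<bullet> y \<le> 0" using c by (simp add: mult_le_0_iff)
    then have "y = 0" using inner_ge_zero[of y] by simp
    then show ?thesis by (simp add: y_def)
  qed
  then show "S = c *\<^sub>R mat 1"
    by (simp add: matrix_eq matrix_vector_mult_scaleR_mat)
qed

lemma det_scalar_2: "det (c *\<^sub>R mat 1 :: real^2^2) = c\<^sup>2"
  by (simp add: det_2 mat_def power2_eq_square)

lemma trace_scalar: "trace (c *\<^sub>R mat 1 :: real^'n::finite^'n) = real CARD('n) * c"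
  by (simp add: trace_def mat_def)

section \<open>Conjugation by the WKB factor and remainder estimates\<close>

lemma ident_mult_deriv_average:
  assumes "smooth_on UNIV g"
  shows "average g x + x * deriv (average g) x = g x"
proof -
  have "((\<lambda>x. x * average g x) has_real_derivative 1 * average g x + deriv (average g) x * x) (at x)"
    by (intro DERIV_mult DERIV_ident smooth_imp_DERIV smooth_average assms)
  from DERIV_unique[OF this ident_mult_average_has_derivative[OF assms]] show ?thesis
    by (simp add: mult.commute)
qed

text \<open>The exponential contributes - 2 \<rho> p^2 f, which cancels the square of the potential,
  and 2 h (m + 1) p f, whose m-part cancels the cross term - 2 h m p f. Everything left has a factor
  h.\<close>

lemma magnetic_laplacian_wkb:
  fixes p \<phi> f :: "real \<Rightarrow> real" and A :: "real^2 \<Rightarrow> real^2"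
  assumes A: "\<And>q. A q = vector [- (q $ 2) * p ((norm q)\<^sup>2 / 2), q $ 1 * p ((norm q)\<^sup>2 / 2)]"
    and \<phi>: "\<And>x. (\<phi> has_real_derivative p x) (at x)"
    and p: "\<And>x. (p has_real_derivative p' x) (at x)"
    and f: "\<And>x. (f has_real_derivative f' x) (at x)"
    and f': "\<And>x. (f' has_real_derivative f'' x) (at x)"
    and h: "h \<noteq> 0"
  defines "\<rho> \<equiv> \<lambda>q::real^2. (norm q)\<^sup>2 / 2"
  shows "magnetic_laplacian h A (\<lambda>q. complex_coord q ^ m * of_real (exp (- \<phi> (\<rho> q) / h) * f (\<rho> q))) q =
    complex_coord q ^ m * of_real (exp (- \<phi> (\<rho> q) / h) * (h *
      (2 * (p (\<rho> q) + \<rho> q * p' (\<rho> q)) * f (\<rho> q) + 4 * \<rho> q * p (\<rho> q) * f' (\<rho> q)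
        - 2 * h * ((real m + 1) * f' (\<rho> q) + \<rho> q * f'' (\<rho> q)))))"
proof -
  define E where "E x = exp (- \<phi> x / h)" for x
  have E: "(E has_real_derivative - (p x / h) * E x) (at x)" for x
    unfolding E_def[abs_def] using h by (auto intro!: derivative_eq_intros \<phi>)
  have w: "((\<lambda>x. E x * f x) has_real_derivative E x * (f' x - p x / h * f x)) (at x)" for x
    by (auto intro!: derivative_eq_intros E f simp: algebra_simps)
  have w': "((\<lambda>x. E x * (f' x - p x / h * f x)) has_real_derivative
      E x * (f'' x - 2 * (p x / h) * f' x - p' x / h * f x + (p x / h)\<^sup>2 * f x)) (at x)" for x
    using h by (auto intro!: derivative_eq_intros E f f' p simp: field_simps power2_eq_square)
  show ?thesis
    unfolding \<rho>_def E_def[symmetric] magnetic_laplacian_power_mult_radial[OF A p w w']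
    using h by (intro arg_cong2[where f = "(*)"] refl arg_cong[where f = of_real])
      (simp add: field_simps power2_eq_square)
qed

text \<open>The hypotheses say that the coefficients of \<open>h\<^sup>0, \<dots>, h\<^sup>J\<close> on the left-hand side vanish.\<close>

lemma truncated_hierarchy_bound:
  fixes t e \<alpha> \<mu> :: "nat \<Rightarrow> real"
  assumes t0: "t 0 = 0" and t: "\<And>j. t (Suc j) = (\<Sum>k\<le>j. \<mu> (Suc k) * \<alpha> (j - k)) + e j"
    and h: "0 \<le> h" "h \<le> 1"
  shows "\<bar>(\<Sum>j\<le>J. t j * h ^ j) - h * (\<Sum>j\<le>J. e j * h ^ j)
      - (\<Sum>j<J. \<mu> (Suc j) * h ^ Suc j) * (\<Sum>j\<le>J. \<alpha> j * h ^ j)\<bar>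
    \<le> h ^ (J + 1) * (\<bar>e J\<bar> + (\<Sum>k<J. \<Sum>j\<le>J. \<bar>\<mu> (Suc k)\<bar> * \<bar>\<alpha> j\<bar>))"
proof -
  define g where "g k j = \<mu> (Suc k) * \<alpha> j * h ^ (k + j)" for k j
  \<comment> \<open>As \<open>t 0 = 0\<close>, the recursion is used only for j < J, which leaves
    \<open>e J\<close> unmatched.\<close>
  have "(\<Sum>j\<le>J. t j * h ^ j) = (\<Sum>j<J. t (Suc j) * h ^ Suc j)"
    unfolding lessThan_Suc_atMost[symmetric] sum.lessThan_Suc_shift by (simp add: t0)
  also have "\<dots> = h * (\<Sum>j<J. \<Sum>k\<le>j. g k (j - k)) + h * (\<Sum>j<J. e j * h ^ j)"
    by (simp add: t g_def sum_distrib_left sum_distrib_right sum.distrib[symmetric] algebra_simps)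
  also have "(\<Sum>j<J. \<Sum>k\<le>j. g k (j - k)) = (\<Sum>(k, j)\<in>{(k, j). k + j < J}. g k j)"
    by (rule sum.triangle_reindex[symmetric])
  finally have 1: "(\<Sum>j\<le>J. t j * h ^ j) =
      h * (\<Sum>(k, j)\<in>{(k, j). k + j < J}. g k j) + h * (\<Sum>j<J. e j * h ^ j)" .
  have 2: "(\<Sum>j\<le>J. e j * h ^ j) = (\<Sum>j<J. e j * h ^ j) + e J * h ^ J"
    by (simp add: lessThan_Suc_atMost[symmetric])
  have "(\<Sum>j<J. \<mu> (Suc j) * h ^ Suc j) * (\<Sum>j\<le>J. \<alpha> j * h ^ j) = h * (\<Sum>k<J. \<Sum>j\<le>J. g k j)"
    by (simp add: sum_product g_def sum_distrib_left power_add mult_ac)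
  also have "(\<Sum>k<J. \<Sum>j\<le>J. g k j) = (\<Sum>(k, j)\<in>{..<J} \<times> {..J}. g k j)"
    by (simp add: sum.cartesian_product)
  \<comment> \<open>Pairs with k + j < J are those produced by the recursion and will cancel; the
    others have k + j at least J and carry h^J.\<close>
  also have "\<dots> = (\<Sum>(k, j)\<in>{..<J} \<times> {..J} - {(k, j). k + j < J}. g k j)
      + (\<Sum>(k, j)\<in>{(k, j). k + j < J}. g k j)"
    by (rule sum.subset_diff) auto
  finally have 3: "(\<Sum>j<J. \<mu> (Suc j) * h ^ Suc j) * (\<Sum>j\<le>J. \<alpha> j * h ^ j) =
      h * (\<Sum>(k, j)\<in>{..<J} \<times> {..J} - {(k, j). k + j < J}. g k j)
      + h * (\<Sum>(k, j)\<in>{(k, j). k + j < J}. g k j)"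
    by (simp add: algebra_simps)
  have "\<bar>\<Sum>(k, j)\<in>{..<J} \<times> {..J} - {(k, j). k + j < J}. g k j\<bar>
      \<le> (\<Sum>(k, j)\<in>{..<J} \<times> {..J} - {(k, j). k + j < J}. h ^ J * (\<bar>\<mu> (Suc k)\<bar> * \<bar>\<alpha> j\<bar>))"
  proof (rule order_trans[OF sum_abs sum_mono])
    fix kj assume kj: "kj \<in> {..<J} \<times> {..J} - {(k, j). k + j < J}"
    obtain k j where [simp]: "kj = (k, j)" by (cases kj)
    from kj h have "h ^ (k + j) \<le> h ^ J" by (intro power_decreasing) auto
    with h have "\<bar>g k j\<bar> \<le> h ^ J * (\<bar>\<mu> (Suc k)\<bar> * \<bar>\<alpha> j\<bar>)"
      by (simp add: g_def abs_mult mult.commute[of "h ^ J"] mult_left_mono)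
    then show "\<bar>case kj of (k, j) \<Rightarrow> g k j\<bar> \<le> (case kj of (k, j) \<Rightarrow> h ^ J * (\<bar>\<mu> (Suc k)\<bar> * \<bar>\<alpha> j\<bar>))"
      by simp
  qed
  also have "\<dots> \<le> (\<Sum>(k, j)\<in>{..<J} \<times> {..J}. h ^ J * (\<bar>\<mu> (Suc k)\<bar> * \<bar>\<alpha> j\<bar>))"
    using h by (intro sum_mono2) auto
  also have "\<dots> = h ^ J * (\<Sum>k<J. \<Sum>j\<le>J. \<bar>\<mu> (Suc k)\<bar> * \<bar>\<alpha> j\<bar>)"
    by (simp add: sum.cartesian_product sum_distrib_left case_prod_unfold)
  finally have 4: "\<bar>\<Sum>(k, j)\<in>{..<J} \<times> {..J} - {(k, j). k + j < J}. g k j\<bar> \<le> \<dots>" .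
  have "(\<Sum>j\<le>J. t j * h ^ j) - h * (\<Sum>j\<le>J. e j * h ^ j)
      - (\<Sum>j<J. \<mu> (Suc j) * h ^ Suc j) * (\<Sum>j\<le>J. \<alpha> j * h ^ j)
    = - (h * (h ^ J * e J + (\<Sum>(k, j)\<in>{..<J} \<times> {..J} - {(k, j). k + j < J}. g k j)))"
    unfolding 1 2 3 by (simp add: algebra_simps)
  also have "\<bar>\<dots>\<bar> = h * \<bar>h ^ J * e J + (\<Sum>(k, j)\<in>{..<J} \<times> {..J} - {(k, j). k + j < J}. g k j)\<bar>"
    using h by (simp add: abs_mult)
  also have "\<dots> \<le> h * (h ^ J * \<bar>e J\<bar> + h ^ J * (\<Sum>k<J. \<Sum>j\<le>J. \<bar>\<mu> (Suc k)\<bar> * \<bar>\<alpha> j\<bar>))"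
    using h 4 by (intro mult_left_mono order_trans[OF abs_triangle_ineq] add_mono) (auto simp: abs_mult)
  finally show ?thesis by (simp add: algebra_simps)
qed

text \<open>Continuity of \<open>c\<close> on the closed half-line, 0 included, bounds it on a
  compact interval, so the constant is uniform even if \<open>K\<close> accumulates at the
  origin.\<close>

lemma bigo_loc_unif_punctured_radialI:
  assumes c: "continuous_on {0..} c"
    and le: "\<And>h q. 0 < h \<Longrightarrow> h \<le> 1 \<Longrightarrow> q \<noteq> 0 \<Longrightarrow> cmod (F h q) \<le> c ((norm q)\<^sup>2 / 2) * h ^ N"
  shows "bigo_loc_unif_punctured F N"
  unfolding bigo_loc_unif_punctured_def
proof (intro allI impI)
  fix K :: "(real^2) set" assume "bounded K"
  then obtain R where R: "\<And>q. q \<in> K \<Longrightarrow> norm q \<le> R" by (auto simp: bounded_iff)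
  have "compact (c ` {0..R\<^sup>2 / 2})"
    by (intro compact_continuous_image continuous_on_subset[OF c]) auto
  then obtain C where C: "\<And>x. x \<in> {0..R\<^sup>2 / 2} \<Longrightarrow> c x \<le> C"
    by (meson bounded_imp_bdd_above compact_imp_bounded bdd_above.E imageI)
  have "cmod (F h q) \<le> C * h ^ N" if "0 < h" "h < 1" "q \<in> K - {0}" for h q
  proof -
    have "(norm q)\<^sup>2 \<le> R\<^sup>2" using R that by (intro power_mono) auto
    then have "c ((norm q)\<^sup>2 / 2) \<le> C" by (intro C) auto
    with that have "c ((norm q)\<^sup>2 / 2) * h ^ N \<le> C * h ^ N" by (intro mult_right_mono) auto
    with that show ?thesis by (intro order_trans[OF le]) auto
  qed
  then show "\<exists>C. \<forall>\<^sub>F h in at_right 0. \<forall>q\<in>K - {0}. cmod (F h q) \<le> C * h ^ N"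
    by (intro exI[of _ C]) (auto simp: eventually_at_right_field intro!: exI[of _ 1])
qed

section \<open>Construction of the quasimodes\<close>

theorem theorem2p5:
  fixes \<beta> :: "real \<Rightarrow> real"
    and B :: "real^2 \<Rightarrow> real"
    and A :: "real^2 \<Rightarrow> real^2"
    and H :: "real^2^2"
  assumes beta_smooth: "smooth_on UNIV \<beta>"
    and beta_pos: "\<forall>r. \<beta> r > 0"
    and beta_min: "\<forall>r>0. \<beta> r > \<beta> 0"
    and beta_deriv: "deriv \<beta> 0 > 0"
    and B_eq: "B = (\<lambda>q. \<beta> (((q $ 1)\<^sup>2 + (q $ 2)\<^sup>2) / 2))"
    and A_eq: "A = radial_gauge B"
    and H_eq: "H = (1/2) *\<^sub>R Hess B 0"
  shows "\<forall>m::nat. \<exists>(\<phi> :: real \<Rightarrow> real) (a :: nat \<Rightarrow> real \<Rightarrow> real) (\<mu> :: nat \<Rightarrow> real).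
    smooth_on {0..} \<phi> \<and> (\<forall>\<rho>\<ge>0. \<phi> \<rho> \<ge> 0) \<and>
    (\<forall>\<rho>\<ge>0. \<phi> \<rho> = 1/2 * integral {0..\<rho>} (\<lambda>\<tau>. integral {0..1} (\<lambda>\<xi>. \<beta> (\<xi> * \<tau>)))) \<and>
    (\<forall>j. smooth_on {0..} (a j)) \<and> (\<forall>\<rho>\<ge>0. a 0 \<rho> > 0) \<and>
    \<mu> 0 = \<beta> 0 \<and>
    \<mu> 1 = 2 * real m * (sqrt (det H) / \<beta> 0) + (trace (matrix_sqrt H))\<^sup>2 / (2 * \<beta> 0) \<and>
    (let P = (\<lambda>q::real^2. \<phi> ((norm q)\<^sup>2 / 2));
         U = (\<lambda>j (q::real^2). a j ((norm q)\<^sup>2 / 2));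
         \<theta> = (\<lambda>q::real^2. Arg (Complex (q $ 1) (q $ 2)))
     in \<forall>J::nat. bigo_loc_unif_punctured
       (\<lambda>h q. let u = (\<lambda>q. exp (\<i> * of_nat m * of_real (\<theta> q))
                    * of_real (((norm q)\<^sup>2 / 2) powr (real m / 2))
                    * of_real (exp (- P q / h))
                    * of_real (\<Sum>j\<le>J. U j q * h ^ j))
              in of_real (exp (P q / h)) * of_real (((norm q)\<^sup>2 / 2) powr (- (real m / 2)))
                 * (magnetic_laplacian h A u q - of_real (h * (\<Sum>j\<le>J. \<mu> j * h ^ j)) * u q))
       (J + 2))"
proof (rule allI)
  fix m :: nat
  \<comment> \<open>\<open>p\<close> is the factor \<alpha> of the gauge as a function of half the
    squared norm. Its primitive \<open>\<phi>\<close> is written as an average, which makes sense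
    for negative x too.\<close>
  define p where "p x = average \<beta> x / 2" for x
  define p' where "p' x = deriv (average \<beta>) x / 2" for x
  define \<phi> where "\<phi> x = x * average p x" for x
  have sp: "smooth_on UNIV p"
    unfolding p_def by (intro smooth_divide smooth_average beta_smooth smooth_const) simp
  have p_pos: "p x > 0" for x
    using average_pos[of \<beta> x] beta_pos smooth_imp_continuous_on[OF beta_smooth] by (simp add: p_def)
  have p: "(p has_real_derivative p' x) (at x)" for x
    unfolding p_def[abs_def] p'_def by (intro DERIV_cdivide smooth_imp_DERIV smooth_average beta_smooth)
  have \<phi>: "(\<phi> has_real_derivative p x) (at x)" for x
    unfolding \<phi>_def[abs_def] by (rule ident_mult_average_has_derivative[OF sp])
  have beta_eq: "2 * (p x + x * p' x) = \<beta> x" for x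
    using ident_mult_deriv_average[OF beta_smooth, of x] by (simp add: p_def p'_def)
  have B: "B = (\<lambda>q. \<beta> ((norm q)\<^sup>2 / 2))"
    by (simp add: B_eq power2_norm_vec_2)
  have A: "A q = vector [- (q $ 2) * p ((norm q)\<^sup>2 / 2), q $ 1 * p ((norm q)\<^sup>2 / 2)]" for q
    unfolding A_eq B p_def by (rule radial_gauge_radial[OF beta_smooth])
  define c where "c = real m + 1"
  \<comment> \<open>Subtracting \<beta>(0) from the zeroth-order coefficient makes it vanish at 0,
    as the leading transport equation requires.\<close>
  define v where "v x = \<beta> x - \<beta> 0" for x
  have sv: "smooth_on UNIV v"
    unfolding v_def by (intro smooth_diff beta_smooth smooth_const)
  have dv: "deriv v 0 = deriv \<beta> 0"
    unfolding v_def[abs_def]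
    by (intro DERIV_imp_deriv) (auto intro!: derivative_eq_intros smooth_imp_DERIV beta_smooth)
  have sp4: "smooth_on UNIV (\<lambda>x. 4 * p x)" "\<And>x. 4 * p x > 0"
    using p_pos by (auto intro: smooth_mult smooth_const sp)
  obtain a \<nu> where a: "\<And>j. smooth_on UNIV (a j)" and a0: "\<And>x. a 0 x > 0"
    and hier0: "\<And>x. v x * a 0 x + x * (4 * p x) * deriv (a 0) x = 0"
    and hier: "\<And>j x. v x * a (Suc j) x + x * (4 * p x) * deriv (a (Suc j)) x =
       (\<Sum>k\<le>j. \<nu> (Suc k) * a (j - k) x) + 2 * (c * deriv (a j) x + x * deriv (deriv (a j)) x)"
    and \<nu>1: "\<nu> 1 = 2 * c * deriv v 0 / (4 * p 0)"
    using transport_hierarchy[OF sp4 sv, of c] by (auto simp: v_def)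
  \<comment> \<open>The hierarchy fixes \<open>\<nu>\<close> at positive indices; index 0 receives
    the leading coefficient.\<close>
  define \<mu> where "\<mu> j = (if j = 0 then \<beta> 0 else \<nu> j)" for j :: nat
  define \<rho> where "\<rho> q = (norm q)\<^sup>2 / 2" for q :: "real^2"
  define e where "e j x = 2 * (c * deriv (a j) x + x * deriv (deriv (a j)) x)" for j x
  have \<phi>_integral: "\<phi> x = 1/2 * integral {0..x} (\<lambda>\<tau>. integral {0..1} (\<lambda>\<xi>. \<beta> (\<xi> * \<tau>)))" if "x \<ge> 0" for x
  proof -
    have "(p has_integral \<phi> x - \<phi> 0) {0..x}"
      using that by (intro fundamental_theorem_of_calculus)
        (auto simp flip: has_real_derivative_iff_has_vector_derivative intro: has_field_derivative_at_within \<phi>)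
    then have "\<phi> x = integral {0..x} p" by (simp add: integral_unique \<phi>_def)
    then show ?thesis by (simp add: p_def[abs_def] average_def[abs_def])
  qed
  have \<phi>_nonneg: "\<phi> x \<ge> 0" if "x \<ge> 0" for x
    using that average_pos[of p x] p_pos smooth_imp_continuous_on[OF sp] by (simp add: \<phi>_def)
  have \<mu>1: "\<mu> 1 = 2 * real m * (sqrt (det H) / \<beta> 0) + (trace (matrix_sqrt H))\<^sup>2 / (2 * \<beta> 0)"
  proof -
    \<comment> \<open>With H = s^2 times the identity, the claimed value is 2 m s^2/\<beta>(0) + (2
      s)^2/(2 \<beta>(0)) = 2 (m + 1) s^2/\<beta>(0). This is \<open>\<nu> 1\<close>, because p(0) =
      \<beta>(0)/2.\<close>
    define s where "s = sqrt (deriv \<beta> 0 / 2)"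
    have s: "s > 0" "s\<^sup>2 = deriv \<beta> 0 / 2" using beta_deriv by (simp_all add: s_def)
    have H: "H = s\<^sup>2 *\<^sub>R mat 1" unfolding H_eq B Hess_radial_at_0[OF beta_smooth] s by simp
    have "\<mu> 1 = (real m + 1) * (2 * s\<^sup>2) / \<beta> 0"
      by (simp add: \<mu>_def \<nu>1[simplified] dv p_def c_def s)
    moreover have "sqrt (det H) = s\<^sup>2" unfolding H det_scalar_2 by (simp only: real_sqrt_abs abs_power2)
    moreover have "trace (matrix_sqrt H) = 2 * s"
      unfolding H matrix_sqrt_scalar[OF s(1)] trace_scalar by simp
    ultimately show ?thesis
      using beta_pos[rule_format, of 0] by (simp add: field_simps power_mult_distrib)
  qed
  have bigo: "bigo_loc_unif_punctured
       (\<lambda>h q. let u = (\<lambda>q. exp (\<i> * of_nat m * of_real (Arg (Complex (q $ 1) (q $ 2))))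
                    * of_real (((norm q)\<^sup>2 / 2) powr (real m / 2))
                    * of_real (exp (- \<phi> ((norm q)\<^sup>2 / 2) / h))
                    * of_real (\<Sum>j\<le>J. a j ((norm q)\<^sup>2 / 2) * h ^ j))
              in of_real (exp (\<phi> ((norm q)\<^sup>2 / 2) / h)) * of_real (((norm q)\<^sup>2 / 2) powr (- (real m / 2)))
                 * (magnetic_laplacian h A u q - of_real (h * (\<Sum>j\<le>J. \<mu> j * h ^ j)) * u q))
       (J + 2)" for J
  proof (rule bigo_loc_unif_punctured_radialI)
    let ?c = "\<lambda>x. \<bar>e J x\<bar> + (\<Sum>k<J. \<Sum>j\<le>J. \<bar>\<nu> (Suc k)\<bar> * \<bar>a j x\<bar>)"
    show "continuous_on {0..} ?c"
      unfolding e_def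
      by (intro continuous_intros smooth_imp_continuous_on smooth_deriv a)
    fix h :: real and q :: "real^2" assume h: "0 < h" "h \<le> 1" and q: "q \<noteq> 0"
    define F where "F x = (\<Sum>j\<le>J. a j x * h ^ j)" for x
    define F' where "F' x = (\<Sum>j\<le>J. deriv (a j) x * h ^ j)" for x
    define F'' where "F'' x = (\<Sum>j\<le>J. deriv (deriv (a j)) x * h ^ j)" for x
    define u where "u q = exp (\<i> * of_nat m * of_real (Arg (Complex (q $ 1) (q $ 2))))
        * of_real (\<rho> q powr (real m / 2)) * of_real (exp (- \<phi> (\<rho> q) / h)) * of_real (F (\<rho> q))" for q
    \<comment> \<open>The constant relating the polar factors to z^m is absorbed into the radial
      amplitude.\<close>
    define \<kappa> where "\<kappa> = 2 powr (- (real m / 2))"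
    have F: "((\<lambda>x. \<kappa> * F x) has_real_derivative \<kappa> * F' x) (at x)"
        "((\<lambda>x. \<kappa> * F' x) has_real_derivative \<kappa> * F'' x) (at x)" for x
      unfolding F_def F'_def F''_def
      by (intro DERIV_cmult DERIV_sum DERIV_cmult_right smooth_imp_DERIV smooth_deriv a)+
    have u: "u q = complex_coord q ^ m * of_real (exp (- \<phi> (\<rho> q) / h) * (\<kappa> * F (\<rho> q)))" if "q \<noteq> 0" for q
      using exp_Arg_mult_radius_powr[OF that, of m]
      by (simp add: u_def \<rho>_def complex_coord_def[of q, symmetric] \<kappa>_def)
    \<comment> \<open>\<open>G\<close> is what remains after extracting z^m,
      \<open>\<kappa>\<close>, the exponential and one factor h. Its last sum stops below J because
      index 0 of \<open>\<mu>\<close> has been spent on \<open>v\<close>.\<close>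
    define G where "G = v (\<rho> q) * F (\<rho> q) + 4 * \<rho> q * p (\<rho> q) * F' (\<rho> q)
        - 2 * h * (c * F' (\<rho> q) + \<rho> q * F'' (\<rho> q)) - (\<Sum>j<J. \<nu> (Suc j) * h ^ Suc j) * F (\<rho> q)"
    have \<mu>_sum: "(\<Sum>j\<le>J. \<mu> j * h ^ j) = \<beta> 0 + (\<Sum>j<J. \<nu> (Suc j) * h ^ Suc j)"
      unfolding lessThan_Suc_atMost[symmetric] sum.lessThan_Suc_shift by (simp add: \<mu>_def)
    have "magnetic_laplacian h A u q = complex_coord q ^ m * of_real (exp (- \<phi> (\<rho> q) / h) * (h *
      (2 * (p (\<rho> q) + \<rho> q * p' (\<rho> q)) * (\<kappa> * F (\<rho> q)) + 4 * \<rho> q * p (\<rho> q) * (\<kappa> * F' (\<rho> q))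
        - 2 * h * ((real m + 1) * (\<kappa> * F' (\<rho> q)) + \<rho> q * (\<kappa> * F'' (\<rho> q))))))"
      using magnetic_laplacian_cong_punctured[of u _ q h A, OF u q]
        magnetic_laplacian_wkb[OF A \<phi> p F, of h m q] h unfolding \<rho>_def by simp
    then have D: "magnetic_laplacian h A u q - of_real (h * (\<Sum>j\<le>J. \<mu> j * h ^ j)) * u q =
        (complex_coord q ^ m * of_real \<kappa>) * of_real (exp (- \<phi> (\<rho> q) / h) * (h * G))"
      unfolding u[OF q] beta_eq \<mu>_sum G_def v_def c_def
      by (simp add: algebra_simps)
    \<comment> \<open>The prefactor has modulus exactly \<rho>^(m/2), which the negative power
      compensates, so nothing is lost near the origin.\<close>
    have "cmod (complex_coord q ^ m * of_real \<kappa>) = \<rho> q powr (real m / 2)"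
      unfolding \<kappa>_def exp_Arg_mult_radius_powr[OF q, symmetric] norm_mult
      by (simp add: \<rho>_def norm_exp_eq_Re)
    then have z: "cmod (complex_coord q ^ m) * \<bar>\<kappa>\<bar> = \<rho> q powr (real m / 2)"
      by (simp add: norm_mult)
    have "\<rho> q > 0" using q by (simp add: \<rho>_def)
    then have "cmod (of_real (exp (\<phi> (\<rho> q) / h)) * of_real (\<rho> q powr (- (real m / 2)))
        * (magnetic_laplacian h A u q - of_real (h * (\<Sum>j\<le>J. \<mu> j * h ^ j)) * u q)) = h * \<bar>G\<bar>"
      unfolding D norm_mult norm_of_real z
      using h by (simp add: exp_minus powr_minus abs_mult field_simps)
    also have "\<dots> \<le> h * (h ^ (J + 1) * ?c (\<rho> q))"
    proof -
      \<comment> \<open>Sorting by powers of h exposes the hierarchy. It makes \<open>G\<close> of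
        order h^(J+1), and the extracted factor h gives h^(J+2).\<close>
      have "G = (\<Sum>j\<le>J. (v (\<rho> q) * a j (\<rho> q) + \<rho> q * (4 * p (\<rho> q)) * deriv (a j) (\<rho> q)) * h ^ j)
          - h * (\<Sum>j\<le>J. e j (\<rho> q) * h ^ j)
          - (\<Sum>j<J. \<nu> (Suc j) * h ^ Suc j) * (\<Sum>j\<le>J. a j (\<rho> q) * h ^ j)"
        unfolding G_def F_def F'_def F''_def e_def
        by (simp add: sum_distrib_left sum.distrib algebra_simps)
      then have "\<bar>G\<bar> \<le> h ^ (J + 1) * ?c (\<rho> q)"
        using truncated_hierarchy_bound[of "\<lambda>j. v (\<rho> q) * a j (\<rho> q) + \<rho> q * (4 * p (\<rho> q)) * deriv (a j) (\<rho> q)"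
            \<nu> "\<lambda>j. a j (\<rho> q)" "\<lambda>j. e j (\<rho> q)" h J] hier0 hier h
        by (simp only: e_def less_imp_le)
      with h show ?thesis by (intro mult_left_mono) auto
    qed
    finally show "cmod (let u = (\<lambda>q. exp (\<i> * of_nat m * of_real (Arg (Complex (q $ 1) (q $ 2))))
                    * of_real (((norm q)\<^sup>2 / 2) powr (real m / 2))
                    * of_real (exp (- \<phi> ((norm q)\<^sup>2 / 2) / h))
                    * of_real (\<Sum>j\<le>J. a j ((norm q)\<^sup>2 / 2) * h ^ j))
              in of_real (exp (\<phi> ((norm q)\<^sup>2 / 2) / h)) * of_real (((norm q)\<^sup>2 / 2) powr (- (real m / 2)))
                 * (magnetic_laplacian h A u q - of_real (h * (\<Sum>j\<le>J. \<mu> j * h ^ j)) * u q))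
        \<le> ?c ((norm q)\<^sup>2 / 2) * h ^ (J + 2)"
      unfolding Let_def u_def[abs_def] F_def \<rho>_def by (simp add: mult_ac)
  qed
  show "\<exists>(\<phi> :: real \<Rightarrow> real) (a :: nat \<Rightarrow> real \<Rightarrow> real) (\<mu> :: nat \<Rightarrow> real).
    smooth_on {0..} \<phi> \<and> (\<forall>\<rho>\<ge>0. \<phi> \<rho> \<ge> 0) \<and>
    (\<forall>\<rho>\<ge>0. \<phi> \<rho> = 1/2 * integral {0..\<rho>} (\<lambda>\<tau>. integral {0..1} (\<lambda>\<xi>. \<beta> (\<xi> * \<tau>)))) \<and>
    (\<forall>j. smooth_on {0..} (a j)) \<and> (\<forall>\<rho>\<ge>0. a 0 \<rho> > 0) \<and>
    \<mu> 0 = \<beta> 0 \<and>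
    \<mu> 1 = 2 * real m * (sqrt (det H) / \<beta> 0) + (trace (matrix_sqrt H))\<^sup>2 / (2 * \<beta> 0) \<and>
    (let P = (\<lambda>q::real^2. \<phi> ((norm q)\<^sup>2 / 2));
         U = (\<lambda>j (q::real^2). a j ((norm q)\<^sup>2 / 2));
         \<theta> = (\<lambda>q::real^2. Arg (Complex (q $ 1) (q $ 2)))
     in \<forall>J::nat. bigo_loc_unif_punctured
       (\<lambda>h q. let u = (\<lambda>q. exp (\<i> * of_nat m * of_real (\<theta> q))
                    * of_real (((norm q)\<^sup>2 / 2) powr (real m / 2))
                    * of_real (exp (- P q / h))
                    * of_real (\<Sum>j\<le>J. U j q * h ^ j))
              in of_real (exp (P q / h)) * of_real (((norm q)\<^sup>2 / 2) powr (- (real m / 2)))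
                 * (magnetic_laplacian h A u q - of_real (h * (\<Sum>j\<le>J. \<mu> j * h ^ j)) * u q))
       (J + 2))"
  proof (rule exI[of _ \<phi>], rule exI[of _ a], rule exI[of _ \<mu>], intro conjI)
    show "smooth_on {0..} \<phi>"
      using smooth_on_subset[OF smooth_if_DERIV_smooth[OF \<phi> sp]] by simp
    show "\<forall>j. smooth_on {0..} (a j)"
      using smooth_on_subset[OF a] by simp
    show "\<mu> 0 = \<beta> 0" by (simp add: \<mu>_def)
    show "\<forall>\<rho>\<ge>0. \<phi> \<rho> \<ge> 0" "\<forall>\<rho>\<ge>0. a 0 \<rho> > 0"
      using \<phi>_nonneg a0 by blast+
    show "\<forall>\<rho>\<ge>0. \<phi> \<rho> = 1/2 * integral {0..\<rho>} (\<lambda>\<tau>. integral {0..1} (\<lambda>\<xi>. \<beta> (\<xi> * \<tau>)))"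
      using \<phi>_integral by blast
  qed (use \<mu>1 bigo in \<open>unfold Let_def, blast+\<close>)
qed

end
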